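(* Let $V\in L^\infty_{loc}(Q_T)$ be nonnegative and let $u\in\bigcap_{1\le p<\infty}W^{2,1}_{p,loc}(Q_T)$ be a positive solution of $\partial_tu-\Delta u+V(x,t)u=0$ in $Q_T$. Assume that, for some $x\in\mathbb{R}^n$, $$\iint_{U\times(0,T)}u(y,t)V(y,t)\,dy\,dt=\infty$$ for any bounded open neighborhood $U$ of $x$. Then, for any bounded open neighborhood $U$ of $x$, $$\limsup_{t\to0}\int_Uu(y,t)\,dy=\infty .$$
   Context: Here $n\ge1$, $T>0$, $Q_T=\mathbb{R}^n\times(0,T]$. $W^{2,1}_{p,loc}(Q_T)$ is the parabolic Sobolev space of functions with two weak space derivatives and one weak time derivative in $L^p_{loc}(Q_T)$. *)

theory Defs
  imports "HOL-Analysis.Analysis"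
begin

text \<open>Points of space-time are pairs \<open>(x, t)\<close>. Elements of Lebesgue and Sobolev spaces are represented
  by total functions of which only the almost-everywhere class on the indicated set matters.\<close>

definition parabolic_cylinder :: "real \<Rightarrow> ((real ^ 'n) \<times> real) set" where
  "parabolic_cylinder T = UNIV \<times> {0<..T}"

definition Lp_loc :: "real \<Rightarrow> 'a::euclidean_space set \<Rightarrow> ('a \<Rightarrow> real) set" where
  "Lp_loc p S = {f. f \<in> borel_measurable (lebesgue_on S) \<and>
     (\<forall>K. compact K \<and> K \<subseteq> S \<longrightarrow> set_integrable lebesgue K (\<lambda>z. \<bar>f z\<bar> powr p))}"

definition Linf_loc :: "'a::euclidean_space set \<Rightarrow> ('a \<Rightarrow> real) set" where
  "Linf_loc S = {f. f \<in> borel_measurable (lebesgue_on S) \<and>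
     (\<forall>K. compact K \<and> K \<subseteq> S \<longrightarrow> (\<exists>C. AE z in lebesgue. z \<in> K \<longrightarrow> \<bar>f z\<bar> \<le> C))}"

primrec C_k :: "nat \<Rightarrow> ('a::euclidean_space \<Rightarrow> real) \<Rightarrow> bool" where
  "C_k 0 f \<longleftrightarrow> continuous_on UNIV f"
| "C_k (Suc k) f \<longleftrightarrow> (\<forall>z. f differentiable (at z)) \<and>
     (\<forall>v. C_k k (\<lambda>z. frechet_derivative f (at z) v))"

definition test_function :: "'a::euclidean_space set \<Rightarrow> ('a \<Rightarrow> real) \<Rightarrow> bool" where
  "test_function \<Omega> \<phi> \<longleftrightarrow> (\<forall>k. C_k k \<phi>) \<and>
     compact (closure {z. \<phi> z \<noteq> 0}) \<and> closure {z. \<phi> z \<noteq> 0} \<subseteq> \<Omega>"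

text \<open>\<open>g\<close> is the weak derivative of \<open>f\<close> in direction \<open>v\<close> on the open set \<open>\<Omega>\<close>.\<close>

definition has_weak_deriv ::
  "('a::euclidean_space \<Rightarrow> real) \<Rightarrow> 'a \<Rightarrow> ('a \<Rightarrow> real) \<Rightarrow> 'a set \<Rightarrow> bool" where
  "has_weak_deriv f v g \<Omega> \<longleftrightarrow> f \<in> Lp_loc 1 \<Omega> \<and> g \<in> Lp_loc 1 \<Omega> \<and>
     (\<forall>\<phi>. test_function \<Omega> \<phi> \<longrightarrow>
        (LINT z:\<Omega>|lebesgue. f z * frechet_derivative \<phi> (at z) v) =
        - (LINT z:\<Omega>|lebesgue. g z * \<phi> z))"

definition space_dir :: "'n \<Rightarrow> (real ^ 'n) \<times> real" where
  "space_dir i = (axis i 1, 0)"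

definition time_dir :: "(real ^ 'n) \<times> real" where
  "time_dir = (0, 1)"

text \<open>The space \<open>W\<^bsup>2,1\<^esup>\<^bsub>p,loc\<^esub>(Q\<^sub>T)\<close>. Weak derivatives are taken in the interior of the cylinder
  \<open>Q\<^sub>T\<close>, whereas local integrability refers to compact subsets of \<open>Q\<^sub>T\<close> itself, which may
  touch the final time \<open>t = T\<close>.\<close>

definition W21_loc :: "real \<Rightarrow> real \<Rightarrow> ((real ^ 'n) \<times> real \<Rightarrow> real) set" where
  "W21_loc p T = {u. u \<in> Lp_loc p (parabolic_cylinder T) \<and>
     (\<exists>ut \<in> Lp_loc p (parabolic_cylinder T).
        has_weak_deriv u time_dir ut (interior (parabolic_cylinder T))) \<and>
     (\<exists>D H. \<forall>i. D i \<in> Lp_loc p (parabolic_cylinder T) \<and>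
        has_weak_deriv u (space_dir i) (D i) (interior (parabolic_cylinder T)) \<and>
        (\<forall>j. H i j \<in> Lp_loc p (parabolic_cylinder T) \<and>
           has_weak_deriv (D i) (space_dir j) (H i j) (interior (parabolic_cylinder T))))}"

text \<open>Strong solutions of \<open>\<partial>\<^sub>t u - \<Delta>u + V u = 0\<close> in \<open>Q\<^sub>T\<close>: the equation holds almost everywhere
  for the weak derivatives, which are unique up to null sets.\<close>

definition strong_solution ::
  "real \<Rightarrow> ((real ^ 'n) \<times> real \<Rightarrow> real) \<Rightarrow> ((real ^ 'n) \<times> real \<Rightarrow> real) \<Rightarrow> bool" where
  "strong_solution T V u \<longleftrightarrow> (\<exists>ut D H.
     has_weak_deriv u time_dir ut (interior (parabolic_cylinder T)) \<and>
     (\<forall>i. has_weak_deriv u (space_dir i) (D i) (interior (parabolic_cylinder T)) \<and>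
          has_weak_deriv (D i) (space_dir i) (H i) (interior (parabolic_cylinder T))) \<and>
     (AE z in lebesgue. z \<in> parabolic_cylinder T \<longrightarrow>
        ut z - (\<Sum>i\<in>UNIV. H i z) + V z * u z = 0))"

end

theory Submission
  imports Defs
begin

text \<open>The equation says that \<open>u V\<close> is the rate at which mass is absorbed. Hence over a time interval
  \<open>(\<epsilon>, \<tau>)\<close> the mass absorbed near \<open>x\<close> is at most the mass present at time \<open>\<epsilon>\<close>, plus what flows in by
  diffusion; and the latter is controlled, after localization, by the time integral of the mass in
  a slightly larger ball. If the masses of the slices stayed bounded as \<open>t \<rightarrow> 0\<close>, then the absorbed
  mass would stay bounded as \<open>\<epsilon> \<rightarrow> 0\<close>, so \<open>u V\<close> would be integrable on a neighbourhood of \<open>x\<close> times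
  \<open>(0, \<tau>)\<close>. Away from time zero it is integrable anyway, because \<open>V\<close> is locally bounded and \<open>u\<close>
  locally integrable up to the final time. This contradicts the assumption on \<open>x\<close>.

  To make this precise, suppose that \<open>\<integral> u(y, t) dy \<le> M\<close> over a ball \<open>B\<close> around \<open>x\<close>, for all small \<open>t\<close>. Test
  the equation with \<open>\<psi>(y, t) = \<Phi>(y) \<eta>(t)\<close>, where \<open>\<Phi>\<close> is a bump supported in \<open>B\<close> and \<open>\<eta>\<close> is a cutoff that
  vanishes before \<open>\<epsilon>\<close> and after \<open>\<tau>\<close>:
  \<open>\<integral>\<integral> u V \<psi> = \<integral>\<integral> u (\<eta> \<Delta>\<Phi> + \<Phi> \<eta>')\<close>, of which the upper bound is \<open>strong_solution_test_le\<close>.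
  Where \<open>\<eta>\<close> decreases, the last term has a favourable sign; where it increases, the integral of \<open>\<eta>'\<close> in
  time is at most \<open>1\<close>, whatever \<open>\<epsilon>\<close> is (\<open>backward_heat_cutoff_le\<close>, \<open>nn_integral_cutoff_slope_le\<close>).
  Integrating slice by slice (\<open>nn_integral_slices_le\<close>) bounds the right-hand side by \<open>M (C \<tau> + 1)\<close>. On a
  smaller ball and for times in \<open>[2 \<epsilon>, \<tau> / 2]\<close> the test function is bounded below uniformly in \<open>\<epsilon>\<close>, and
  this gives \<open>absorption_nn_integral_le\<close>; monotone convergence then lets \<open>\<epsilon>\<close> tend to \<open>0\<close>.

  Neither \<open>\<Phi>\<close> nor \<open>\<eta>\<close> has to equal \<open>1\<close> anywhere: a uniform positive lower bound suffices. Both can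
  therefore be built from \<open>exp (- 1 / s)\<close> directly.\<close>

section \<open>Functions of class \<open>C\<^sup>k\<close>\<close>

lemma C_k_SucI:
  assumes "\<And>z. (f has_derivative F z) (at z)" and "\<And>v. C_k k (\<lambda>z. F z v)"
  shows "C_k (Suc k) f"
proof -
  have "frechet_derivative f (at z) = F z" for z
    using frechet_derivative_at[OF assms(1)] by simp
  then show ?thesis
    using assms by (auto simp: differentiable_def)
qed

lemma C_k_SucD:
  assumes "C_k (Suc k) f"
  shows "(f has_derivative frechet_derivative f (at z)) (at z)"
    and "C_k k (\<lambda>z. frechet_derivative f (at z) v)"
  using assms by (auto simp: frechet_derivative_works)

lemma C_k_Suc_imp: "C_k (Suc k) f \<Longrightarrow> C_k k f"
proof (induction k arbitrary: f)
  case 0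
  then show ?case
    by (auto intro!: continuous_at_imp_continuous_on differentiable_imp_continuous_within)
next
  case (Suc k)
  then show ?case by (metis C_k.simps(2))
qed

lemma C_k_const [simp]: "C_k k (\<lambda>_. c)"
proof (induction k arbitrary: c)
  case (Suc k)
  show ?case by (rule C_k_SucI[OF has_derivative_const]) (rule Suc)
qed simp

lemma C_k_add: "C_k k f \<Longrightarrow> C_k k g \<Longrightarrow> C_k k (\<lambda>z. f z + g z)"
proof (induction k arbitrary: f g)
  case 0
  then show ?case by (auto intro: continuous_on_add)
next
  case (Suc k)
  show ?case
    by (rule C_k_SucI[OF has_derivative_add[OF C_k_SucD(1)[OF Suc.prems(1)] C_k_SucD(1)[OF Suc.prems(2)]]])
      (intro Suc.IH C_k_SucD(2)[OF Suc.prems(1)] C_k_SucD(2)[OF Suc.prems(2)])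
qed

lemma C_k_mult: "C_k k f \<Longrightarrow> C_k k g \<Longrightarrow> C_k k (\<lambda>z. f z * g z)"
proof (induction k arbitrary: f g)
  case 0
  then show ?case by (auto intro: continuous_on_mult)
next
  case (Suc k)
  show ?case
    by (rule C_k_SucI[OF has_derivative_mult[OF C_k_SucD(1)[OF Suc.prems(1)] C_k_SucD(1)[OF Suc.prems(2)]]])
      (intro C_k_add Suc.IH C_k_SucD(2)[OF Suc.prems(1)] C_k_SucD(2)[OF Suc.prems(2)]
         C_k_Suc_imp[OF Suc.prems(1)] C_k_Suc_imp[OF Suc.prems(2)])
qed

lemma C_k_bounded_linear:
  fixes L :: "'a::euclidean_space \<Rightarrow> real"
  assumes "bounded_linear L"
  shows "C_k k L"
proof (cases k)
  case 0
  then show ?thesis using assms by (simp add: linear_continuous_on)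
next
  case (Suc j)
  show ?thesis unfolding Suc
    by (rule C_k_SucI[OF bounded_linear_imp_has_derivative[OF assms] C_k_const])
qed

section \<open>The flat exponential\<close>

text \<open>The functions \<open>exp (- 1 / s) / s ^ m\<close>, extended by \<open>0\<close> to \<open>s \<le> 0\<close>. The cutoffs need only
  \<open>m = 0\<close>, but the derivative of a member is a combination of later members, so the whole family is
  what an induction on the order of differentiability can carry.\<close>

definition flat_exp :: "nat \<Rightarrow> real \<Rightarrow> real" where
  "flat_exp m s = (if s > 0 then exp (- (1 / s)) / s ^ m else 0)"

lemma flat_exp_tendsto_0: "(flat_exp m \<longlongrightarrow> 0) (at 0)"
proof -
  have "((\<lambda>s. (inverse s) ^ m / exp (inverse s)) \<longlongrightarrow> (0::real)) (at_right 0)"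
    by (rule filterlim_compose[OF tendsto_power_div_exp_0 filterlim_inverse_at_top_right])
  moreover have "eventually (\<lambda>s. (inverse s) ^ m / exp (inverse s) = flat_exp m s) (at_right 0)"
    by (rule eventually_at_right_less[THEN eventually_mono])
      (auto simp: flat_exp_def exp_minus field_simps)
  ultimately have r: "(flat_exp m \<longlongrightarrow> 0) (at_right 0)"
    by (rule Lim_transform_eventually)
  have "eventually (\<lambda>s. 0 = flat_exp m s) (at_left 0)"
    unfolding eventually_at_left_field flat_exp_def by (auto intro!: exI[of _ "-1"])
  then have "(flat_exp m \<longlongrightarrow> 0) (at_left 0)"
    by (rule Lim_transform_eventually[OF tendsto_const])
  with r show ?thesis using filterlim_at_split by blast
qed

text \<open>Away from \<open>0\<close> this is calculus. At \<open>0\<close> the difference quotient of member \<open>m\<close> is the value of member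
  \<open>m + 1\<close>, which tends to \<open>0\<close>.\<close>

lemma flat_exp_has_derivative:
  "(flat_exp m has_real_derivative flat_exp (m + 2) s - m * flat_exp (m + 1) s) (at s)"
proof -
  consider "s > 0" | "s < 0" | "s = 0" by linarith
  then show ?thesis
  proof cases
    case 1
    have e: "((\<lambda>s. exp (- (1 / s))) has_real_derivative exp (- (1 / s)) / s\<^sup>2) (at s)"
      using 1 by (auto intro!: derivative_eq_intros simp: power2_eq_square)
    have p: "((\<lambda>s. s ^ m) has_real_derivative m * s ^ (m - 1)) (at s)"
      using DERIV_pow[of m s UNIV] by simp
    have m: "real m * s ^ (m - 1) = m * s ^ m / s"
      using 1 by (cases m) auto
    have "((\<lambda>s. exp (- (1 / s)) / s ^ m) has_real_derivative
        flat_exp (m + 2) s - m * flat_exp (m + 1) s) (at s)"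
    proof (rule DERIV_cong[OF DERIV_divide[OF e p[unfolded m]]])
      have "(E / s\<^sup>2 * P - E * (real m * P / s)) / (P * P) = E / (P * s\<^sup>2) - m * (E / (P * s))" if "P > 0" for E P :: real
        using 1 that by (simp add: divide_simps power2_eq_square) (simp add: algebra_simps)
      moreover have "flat_exp (m + 2) s - m * flat_exp (m + 1) s
          = exp (- (1 / s)) / (s ^ m * s\<^sup>2) - m * (exp (- (1 / s)) / (s ^ m * s))"
        using 1 by (simp add: flat_exp_def power_add power2_eq_square mult_ac)
      ultimately show "(exp (- (1 / s)) / s\<^sup>2 * s ^ m - exp (- (1 / s)) * (m * s ^ m / s)) / (s ^ m * s ^ m)
          = flat_exp (m + 2) s - m * flat_exp (m + 1) s"
        using 1 by simp
    qed (use 1 in simp)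
    then show ?thesis
      by (rule has_field_derivative_transform_within_open[where S="{0<..}"])
        (use 1 in \<open>auto simp: flat_exp_def\<close>)
  next
    case 2
    have "((\<lambda>s. 0) has_real_derivative flat_exp (m + 2) s - m * flat_exp (m + 1) s) (at s)"
      using 2 by (simp add: flat_exp_def)
    then show ?thesis
      by (rule has_field_derivative_transform_within_open[where S="{..<0}"])
        (use 2 in \<open>auto simp: flat_exp_def\<close>)
  next
    case 3
    have "((\<lambda>h. (flat_exp m (0 + h) - flat_exp m 0) / h) \<longlongrightarrow> 0) (at 0)"
      by (rule Lim_transform_eventually[OF flat_exp_tendsto_0[of "Suc m"]])
        (auto simp: flat_exp_def eventually_at_filter field_simps)
    then show ?thesis using 3 by (simp add: DERIV_def flat_exp_def)
  qed
qed

text \<open>By the chain rule a first derivative of the composition is a combination of compositions with members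
  \<open>m + 1\<close> and \<open>m + 2\<close>, times a first derivative of \<open>f\<close>; hence the induction over all \<open>m\<close> at once.\<close>

lemma C_k_flat_exp:
  assumes "C_k k f"
  shows "C_k k (\<lambda>z. flat_exp m (f z))"
  using assms
proof (induction k arbitrary: m)
  case 0
  have "continuous_on UNIV (flat_exp m)"
    using DERIV_isCont[OF flat_exp_has_derivative] by (simp add: continuous_at_imp_continuous_on)
  with 0 show ?case using continuous_on_compose2[of UNIV "flat_exp m" UNIV f] by simp
next
  case (Suc k)
  let ?D = "\<lambda>z v. (flat_exp (m + 2) (f z) + (- real m) * flat_exp (m + 1) (f z))
        * frechet_derivative f (at z) v"
  have d: "((\<lambda>z. flat_exp m (f z)) has_derivative ?D z) (at z)" for z
    using has_derivative_compose[OF C_k_SucD(1)[OF Suc.prems(1), of z]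
        flat_exp_has_derivative[unfolded has_field_derivative_def, of m "f z"]]
    by simp
  show ?case
    by (rule C_k_SucI[OF d]) (intro C_k_mult C_k_add C_k_const Suc.IH C_k_Suc_imp[OF Suc.prems(1)]
        C_k_SucD(2)[OF Suc.prems(1)])
qed

lemma flat_exp_bounds: "0 \<le> flat_exp m s" "flat_exp 0 s \<le> 1"
  by (auto simp: flat_exp_def)

lemma flat_exp_0_mono: "s \<le> s' \<Longrightarrow> flat_exp 0 s \<le> flat_exp 0 s'"
  by (auto simp: flat_exp_def frac_le)

section \<open>Test functions and weak solutions\<close>

lemma frechet_derivative_outside_support:
  assumes "z \<notin> closure {z. \<phi> z \<noteq> 0}"
  shows "frechet_derivative \<phi> (at z) v = 0"
proof -
  have "((\<lambda>_. 0) has_derivative (\<lambda>_. 0)) (at z)" by simp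
  then have "(\<phi> has_derivative (\<lambda>_. 0)) (at z)"
    by (rule has_derivative_transform_within_open[where s="- closure {z. \<phi> z \<noteq> 0}"])
      (use assms closure_subset[of "{z. \<phi> z \<noteq> 0}"] in auto)
  from frechet_derivative_at[OF this, symmetric] show ?thesis by simp
qed

lemma test_function_derivative_support:
  "closure {z. frechet_derivative \<phi> (at z) v \<noteq> 0} \<subseteq> closure {z. \<phi> z \<noteq> 0}"
  using frechet_derivative_outside_support[of _ \<phi> v] by (intro closure_minimal) auto

lemma test_function_derivative:
  assumes "test_function \<Omega> \<phi>"
  shows "test_function \<Omega> (\<lambda>z. frechet_derivative \<phi> (at z) v)"
proof -
  note test_function_derivative_support[of \<phi> v]
  moreover have "C_k k (\<lambda>z. frechet_derivative \<phi> (at z) v)" for k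
    using assms C_k.simps(2) unfolding test_function_def by blast
  moreover have "compact (closure {z. frechet_derivative \<phi> (at z) v \<noteq> 0})"
  proof -
    have "bounded (closure {z. \<phi> z \<noteq> 0})"
      using assms unfolding test_function_def by (blast intro: compact_imp_bounded)
    then have "bounded (closure {z. frechet_derivative \<phi> (at z) v \<noteq> 0})"
      using calculation(1) by (rule bounded_subset)
    then show ?thesis by (simp add: compact_eq_bounded_closed)
  qed
  ultimately show ?thesis using assms unfolding test_function_def by (intro conjI allI) auto
qed

text \<open>On its compact support the test function is bounded and \<open>g\<close> is integrable; off the support the product
  vanishes.\<close>

lemma Lp_loc_1_mult_test_function:
  assumes g: "g \<in> Lp_loc 1 \<Omega>" and \<phi>: "test_function \<Omega> \<phi>" and \<Omega>: "open \<Omega>"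
  shows "set_integrable lebesgue \<Omega> (\<lambda>z. g z * \<phi> z)"
proof -
  let ?K = "closure {z. \<phi> z \<noteq> 0}"
  have K: "compact ?K" "?K \<subseteq> \<Omega>" using \<phi> by (auto simp: test_function_def)
  have c: "continuous_on UNIV \<phi>" using \<phi> unfolding test_function_def by (metis C_k.simps(1))
  have "compact (\<phi> ` ?K)" using K(1) c by (meson compact_continuous_image continuous_on_subset subset_UNIV)
  then obtain B where B: "\<And>z. z \<in> ?K \<Longrightarrow> \<bar>\<phi> z\<bar> \<le> B"
    using compact_imp_bounded[of "\<phi> ` ?K"] unfolding bounded_real by auto
  have gi: "set_integrable lebesgue ?K (\<lambda>z. B * \<bar>g z\<bar>)"
    using g K by (simp add: Lp_loc_def)
  have "g \<in> borel_measurable (lebesgue_on \<Omega>)" using g by (simp add: Lp_loc_def)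
  moreover have "\<phi> \<in> borel_measurable (lebesgue_on \<Omega>)"
    using c by (intro measurable_restrict_space1 measurable_completion) (simp add: borel_measurable_continuous_onI)
  ultimately have "(\<lambda>z. g z * \<phi> z) \<in> borel_measurable (lebesgue_on \<Omega>)" by simp
  then have m: "(\<lambda>z. indicator \<Omega> z *\<^sub>R (g z * \<phi> z)) \<in> borel_measurable lebesgue"
    using \<Omega> by (subst (asm) borel_measurable_restrict_space_iff) auto
  show ?thesis unfolding set_integrable_def
  proof (rule Bochner_Integration.integrable_bound[OF gi[unfolded set_integrable_def] m], rule AE_I2)
    fix z
    show "norm (indicator \<Omega> z *\<^sub>R (g z * \<phi> z)) \<le> norm (indicator ?K z *\<^sub>R (B * \<bar>g z\<bar>))"
    proof (cases "z \<in> ?K")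
      case True
      then have "z \<in> \<Omega>" "\<bar>g z\<bar> * \<bar>\<phi> z\<bar> \<le> \<bar>g z\<bar> * \<bar>B\<bar>"
        using K B[of z] by (auto intro!: mult_left_mono)
      with True show ?thesis by (simp add: abs_mult mult.commute)
    next
      case False
      then have "\<phi> z = 0" using closure_subset[of "{z. \<phi> z \<noteq> 0}"] by auto
      then show ?thesis by simp
    qed
  qed
qed

lemma weak_derivD:
  assumes "has_weak_deriv f v g \<Omega>" "test_function \<Omega> \<phi>"
  shows "(LINT z:\<Omega>|lebesgue. g z * \<phi> z) = - (LINT z:\<Omega>|lebesgue. f z * frechet_derivative \<phi> (at z) v)"
  using assms by (simp add: has_weak_deriv_def)

lemma interior_parabolic_cylinder:
  "interior (parabolic_cylinder T :: ((real ^ 'n) \<times> real) set) = UNIV \<times> {0<..<T}"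
  by (simp add: parabolic_cylinder_def interior_Times interior_lessThanAtMost)

text \<open>Up to sign, the formal adjoint of \<open>\<partial>\<^sub>t - \<Delta>\<close> applied to \<open>\<psi>\<close>.\<close>

definition backward_heat :: "((real ^ 'n) \<times> real \<Rightarrow> real) \<Rightarrow> (real ^ 'n) \<times> real \<Rightarrow> real" where
  "backward_heat \<psi> z =
     (\<Sum>i\<in>UNIV. frechet_derivative (\<lambda>z. frechet_derivative \<psi> (at z) (space_dir i)) (at z) (space_dir i))
     + frechet_derivative \<psi> (at z) time_dir"

lemma integral_le_nn_integral:
  fixes f :: "'a \<Rightarrow> real"
  assumes "integrable M f"
  shows "ennreal (integral\<^sup>L M f) \<le> (\<integral>\<^sup>+ z. ennreal (f z) \<partial>M)"
proof -
  have i: "integrable M (\<lambda>z. max 0 (f z))" using assms by simp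
  have "integral\<^sup>L M f \<le> (LINT z|M. max 0 (f z))"
    using assms i by (intro integral_mono) auto
  then have "ennreal (integral\<^sup>L M f) \<le> ennreal (LINT z|M. max 0 (f z))" by (rule ennreal_leI)
  also have "\<dots> = (\<integral>\<^sup>+ z. ennreal (max 0 (f z)) \<partial>M)"
    using nn_integral_eq_integral[OF i] by simp
  also have "\<dots> = (\<integral>\<^sup>+ z. ennreal (f z) \<partial>M)"
    by (intro nn_integral_cong) (simp add: max_def ennreal_neg)
  finally show ?thesis .
qed

text \<open>Multiply the equation by \<open>\<psi>\<close> and move all derivatives to \<open>\<psi>\<close>: two steps of integration by parts
  in each space direction, one in time. This gives the equality \<open>\<integral> u V \<psi> = \<integral> u (\<Delta>\<psi> + \<partial>\<^sub>t\<psi>)\<close> of real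
  integrals. On the right, only the positive part of the integrand is kept, because an upper bound is
  all that is wanted and the positive part can be estimated pointwise.\<close>

lemma strong_solution_test_le:
  fixes u V :: "(real ^ 'n) \<times> real \<Rightarrow> real" and T :: real
  defines "\<Omega> \<equiv> (UNIV :: (real ^ 'n) set) \<times> {0<..<T}"
  assumes sol: "strong_solution T V u" and \<psi>: "test_function \<Omega> \<psi>"
    and nonneg: "AE z in lebesgue. z \<in> \<Omega> \<longrightarrow> 0 \<le> u z * V z * \<psi> z"
  shows "(\<integral>\<^sup>+ z\<in>\<Omega>. ennreal (u z * V z * \<psi> z) \<partial>lebesgue)
       \<le> (\<integral>\<^sup>+ z\<in>\<Omega>. ennreal (u z * backward_heat \<psi> z) \<partial>lebesgue)"
proof -
  have \<Omega>: "open \<Omega>" "\<Omega> \<subseteq> parabolic_cylinder T" "interior (parabolic_cylinder T) = \<Omega>"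
    unfolding \<Omega>_def by (auto simp: open_Times parabolic_cylinder_def interior_parabolic_cylinder[unfolded parabolic_cylinder_def])
  obtain ut D H where wd: "has_weak_deriv u time_dir ut \<Omega>"
      "\<And>i. has_weak_deriv u (space_dir i) (D i) \<Omega>" "\<And>i. has_weak_deriv (D i) (space_dir i) (H i) \<Omega>"
    and eq: "AE z in lebesgue. z \<in> parabolic_cylinder T \<longrightarrow> ut z - (\<Sum>i\<in>UNIV. H i z) + V z * u z = 0"
    using sol unfolding strong_solution_def \<Omega>(3) by blast
  have L: "u \<in> Lp_loc 1 \<Omega>" "ut \<in> Lp_loc 1 \<Omega>" "H i \<in> Lp_loc 1 \<Omega>" for i
    using wd by (auto simp: has_weak_deriv_def)
  let ?d = "\<lambda>v z. frechet_derivative \<psi> (at z) v"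
  let ?dd = "\<lambda>v z. frechet_derivative (?d v) (at z) v"
  have t1: "test_function \<Omega> (?d v)" and t2: "test_function \<Omega> (?dd v)" for v
    by (intro test_function_derivative \<psi>)+
  note int = Lp_loc_1_mult_test_function[OF _ _ \<Omega>(1)]
  let ?g = "\<lambda>z. (\<Sum>i\<in>UNIV. H i z * \<psi> z) - ut z * \<psi> z"
  let ?h = "\<lambda>z. (\<Sum>i\<in>UNIV. u z * ?dd (space_dir i) z) + u z * ?d time_dir z"
  have iH: "set_integrable lebesgue \<Omega> (\<lambda>z. \<Sum>i\<in>UNIV. H i z * \<psi> z)"
    and iu: "set_integrable lebesgue \<Omega> (\<lambda>z. \<Sum>i\<in>UNIV. u z * ?dd (space_dir i) z)"
    using int[OF L(3) \<psi>] int[OF L(1) t2] unfolding set_integrable_def 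
    by (simp_all only: scaleR_sum_right Bochner_Integration.integrable_sum)
  \<comment> \<open>\<open>?g\<close> stands for \<open>u V \<psi>\<close>, which it equals almost everywhere by the equation.\<close>
  have ig: "set_integrable lebesgue \<Omega> ?g"
    by (intro set_integral_diff iH int L \<psi>)
  have ih: "set_integrable lebesgue \<Omega> ?h"
    by (intro set_integral_add iu int L t1)
  have H: "(LINT z:\<Omega>|lebesgue. H i z * \<psi> z) = (LINT z:\<Omega>|lebesgue. u z * ?dd (space_dir i) z)" for i
    using weak_derivD[OF wd(3) \<psi>] weak_derivD[OF wd(2) t1] by simp
  have "(LINT z:\<Omega>|lebesgue. ?g z) = (LINT z:\<Omega>|lebesgue. \<Sum>i\<in>UNIV. H i z * \<psi> z) - (LINT z:\<Omega>|lebesgue. ut z * \<psi> z)"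
    by (intro set_integral_diff iH int L \<psi>)
  also have "(LINT z:\<Omega>|lebesgue. \<Sum>i\<in>UNIV. H i z * \<psi> z) = (\<Sum>i\<in>UNIV. LINT z:\<Omega>|lebesgue. H i z * \<psi> z)"
    using int[OF L(3) \<psi>] unfolding set_integrable_def set_lebesgue_integral_def
    by (simp only: scaleR_sum_right Bochner_Integration.integral_sum)
  also have "\<dots> = (\<Sum>i\<in>UNIV. LINT z:\<Omega>|lebesgue. u z * ?dd (space_dir i) z)"
    by (simp only: H)
  also have "\<dots> = (LINT z:\<Omega>|lebesgue. \<Sum>i\<in>UNIV. u z * ?dd (space_dir i) z)"
    using int[OF L(1) t2] unfolding set_integrable_def set_lebesgue_integral_def
    by (simp only: scaleR_sum_right Bochner_Integration.integral_sum)
  also have "(LINT z:\<Omega>|lebesgue. ut z * \<psi> z) = - (LINT z:\<Omega>|lebesgue. u z * ?d time_dir z)"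
    by (rule weak_derivD[OF wd(1) \<psi>])
  also have "(LINT z:\<Omega>|lebesgue. \<Sum>i\<in>UNIV. u z * ?dd (space_dir i) z) - - (LINT z:\<Omega>|lebesgue. u z * ?d time_dir z)
      = (LINT z:\<Omega>|lebesgue. ?h z)"
    by (subst set_integral_add(2)[OF iu int[OF L(1) t1]]) simp
  finally have gh: "(LINT z:\<Omega>|lebesgue. ?g z) = (LINT z:\<Omega>|lebesgue. ?h z)" .
  have ae: "AE z in lebesgue. z \<in> \<Omega> \<longrightarrow> u z * V z * \<psi> z = ?g z"
    using eq
  proof eventually_elim
    case (elim z)
    show ?case
    proof
      assume "z \<in> \<Omega>"
      with elim \<Omega>(2) have "V z * u z = (\<Sum>i\<in>UNIV. H i z) - ut z" by auto
      then have "(V z * u z) * \<psi> z = ((\<Sum>i\<in>UNIV. H i z) - ut z) * \<psi> z" by simp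
      then show "u z * V z * \<psi> z = ?g z"
        unfolding sum_distrib_right[symmetric] by (simp add: algebra_simps)
    qed
  qed
  have "(\<integral>\<^sup>+ z\<in>\<Omega>. ennreal (u z * V z * \<psi> z) \<partial>lebesgue) = (\<integral>\<^sup>+ z. ennreal (indicator \<Omega> z *\<^sub>R ?g z) \<partial>lebesgue)"
    using ae by (intro nn_integral_cong_AE) (auto elim!: eventually_mono split: split_indicator)
  also have "\<dots> = ennreal (LINT z:\<Omega>|lebesgue. ?g z)"
    unfolding set_lebesgue_integral_def
  proof (rule nn_integral_eq_integral[OF ig[unfolded set_integrable_def]])
    show "AE z in lebesgue. 0 \<le> indicator \<Omega> z *\<^sub>R ?g z"
      using ae nonneg by eventually_elim (auto split: split_indicator)
  qed
  also have "\<dots> \<le> (\<integral>\<^sup>+ z. ennreal (indicator \<Omega> z *\<^sub>R ?h z) \<partial>lebesgue)"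
    unfolding gh unfolding set_lebesgue_integral_def
    by (rule integral_le_nn_integral[OF ih[unfolded set_integrable_def]])
  also have "\<dots> = (\<integral>\<^sup>+ z\<in>\<Omega>. ennreal (u z * backward_heat \<psi> z) \<partial>lebesgue)"
    by (intro nn_integral_cong)
      (auto simp: backward_heat_def distrib_left sum_distrib_left split: split_indicator)
  finally show ?thesis .
qed

section \<open>Cutoff functions concentrated near a point and away from time zero\<close>

lemma frechet_derivative_mult_time:
  assumes f: "(f has_derivative f') (at z)" and \<eta>: "(\<eta> has_real_derivative d) (at (snd z))"
  shows "frechet_derivative (\<lambda>z. f z * \<eta> (snd z)) (at z) v = f z * (d * snd v) + f' v * \<eta> (snd z)"
proof -
  have "((\<lambda>z. \<eta> (snd z)) has_derivative (\<lambda>v. d * snd v)) (at z)"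
    using has_derivative_compose[OF has_derivative_snd[OF has_derivative_ident] \<eta>[unfolded has_field_derivative_def]] .
  from frechet_derivative_at[OF has_derivative_mult[OF f this], symmetric] show ?thesis
    by simp
qed

definition space_bump :: "real \<Rightarrow> (real ^ 'n) \<Rightarrow> (real ^ 'n) \<times> real \<Rightarrow> real" where
  "space_bump r x z = flat_exp 0 (r\<^sup>2 - (fst z - x) \<bullet> (fst z - x))"

text \<open>Supported in \<open>[\<epsilon>, \<tau>]\<close> when \<open>\<epsilon> > 0\<close>. The rescaling of the left flank by \<open>\<epsilon>\<close> keeps the function bounded
  below on \<open>[2 \<epsilon>, \<tau> / 2]\<close> uniformly in \<open>\<epsilon>\<close>, while the total increase of that flank stays at most \<open>1\<close>.\<close>

definition time_cutoff :: "real \<Rightarrow> real \<Rightarrow> real \<Rightarrow> real" where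
  "time_cutoff \<tau> \<epsilon> t = flat_exp 0 (t / \<epsilon> - 1) * flat_exp 0 (\<tau> - t)"

lemma C_k_affine:
  fixes L :: "'a::euclidean_space \<Rightarrow> real"
  assumes "bounded_linear L"
  shows "C_k k (\<lambda>z. L z + c)"
  by (intro C_k_add C_k_bounded_linear C_k_const assms)

lemma C_k_space_bump:
  fixes x :: "real ^ 'n"
  shows "C_k k (space_bump r x)"
proof -
  have lin: "C_k k (\<lambda>z :: (real ^ 'n) \<times> real. c * ((fst z - x) \<bullet> w))" for k w c
  proof -
    have "C_k k (\<lambda>z :: (real ^ 'n) \<times> real. c * (fst z \<bullet> w) + (- (c * (x \<bullet> w))))"
      by (rule C_k_affine) (intro bounded_linear_const_mult bounded_linear_inner_left_comp bounded_linear_fst)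
    then show ?thesis by (simp add: algebra_simps)
  qed
  have d: "((\<lambda>z. r\<^sup>2 - (fst z - x) \<bullet> (fst z - x)) has_derivative (\<lambda>v. (- 2) * ((fst z - x) \<bullet> fst v))) (at z)"
    for z :: "(real ^ 'n) \<times> real"
    by (auto intro!: derivative_eq_intros simp: inner_commute)
  have "C_k (Suc k) (\<lambda>z :: (real ^ 'n) \<times> real. r\<^sup>2 - (fst z - x) \<bullet> (fst z - x))"
    by (rule C_k_SucI[OF d]) (rule lin)
  from C_k_flat_exp[OF C_k_Suc_imp[OF this]] show ?thesis
    unfolding space_bump_def[abs_def] .
qed

lemma space_bump_time_derivative: "frechet_derivative (space_bump r x) (at z) time_dir = 0"
proof -
  have "((\<lambda>z. r\<^sup>2 - (fst z - x) \<bullet> (fst z - x)) has_derivative (\<lambda>v. (- 2) * ((fst z - x) \<bullet> fst v))) (at z)"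
    by (auto intro!: derivative_eq_intros simp: inner_commute)
  from frechet_derivative_at[OF has_derivative_compose[OF this flat_exp_has_derivative[unfolded has_field_derivative_def]], symmetric]
  show ?thesis unfolding space_bump_def[abs_def] by (simp add: time_dir_def)
qed

lemma C_k_time_cutoff: "C_k k (\<lambda>z :: (real ^ 'n) \<times> real. time_cutoff \<tau> \<epsilon> (snd z))"
proof -
  have "C_k k (\<lambda>z :: (real ^ 'n) \<times> real. snd z * (1 / \<epsilon>) + (- 1))"
    and "C_k k (\<lambda>z :: (real ^ 'n) \<times> real. (- snd z) + \<tau>)"
    by (intro C_k_affine bounded_linear_mult_const bounded_linear_snd bounded_linear_minus)+
  from C_k_mult[OF C_k_flat_exp[OF this(1)] C_k_flat_exp[OF this(2)]]
  show ?thesis unfolding time_cutoff_def by simp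
qed

lemma test_function_cutoff:
  fixes x :: "real ^ 'n"
  assumes "\<epsilon> > 0" "\<tau> < T" "r > 0"
  defines "\<psi> \<equiv> \<lambda>z. space_bump r x z * time_cutoff \<tau> \<epsilon> (snd z)"
  shows "test_function (UNIV \<times> {0<..<T}) \<psi>" and "closure {z. \<psi> z \<noteq> 0} \<subseteq> cball x r \<times> {0<..\<tau>}"
proof -
  have "(y, t) \<in> cball x r \<times> {\<epsilon>..\<tau>}" if "\<psi> (y, t) \<noteq> 0" for y t
  proof -
    have "(y - x) \<bullet> (y - x) < r\<^sup>2" "t / \<epsilon> > 1" "t < \<tau>"
      using that by (auto simp: \<psi>_def space_bump_def time_cutoff_def flat_exp_def split: if_splits)
    then have "(norm (y - x))\<^sup>2 < r\<^sup>2" "t > \<epsilon>" using \<open>\<epsilon> > 0\<close> by (auto simp: power2_norm_eq_inner field_simps)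
    then have "norm (y - x) < r" using \<open>r > 0\<close> by (simp add: power_less_imp_less_base)
    then show ?thesis using \<open>t > \<epsilon>\<close> \<open>t < \<tau>\<close> by (simp add: dist_norm norm_minus_commute)
  qed
  then have sub: "closure {z. \<psi> z \<noteq> 0} \<subseteq> cball x r \<times> {\<epsilon>..\<tau>}"
    by (intro closure_minimal closed_Times) auto
  then show "closure {z. \<psi> z \<noteq> 0} \<subseteq> cball x r \<times> {0<..\<tau>}" using \<open>\<epsilon> > 0\<close> by fastforce
  have "compact (cball x r \<times> {\<epsilon>..\<tau>})" by (intro compact_Times) auto
  then have "compact (closure {z. \<psi> z \<noteq> 0})"
    using bounded_subset[OF compact_imp_bounded sub] by (simp add: compact_eq_bounded_closed)
  moreover have "closure {z. \<psi> z \<noteq> 0} \<subseteq> UNIV \<times> {0<..<T}" using sub assms by fastforce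
  moreover have "C_k k \<psi>" for k
    unfolding \<psi>_def by (intro C_k_mult C_k_space_bump C_k_time_cutoff)
  ultimately show "test_function (UNIV \<times> {0<..<T}) \<psi>" by (simp add: test_function_def)
qed

text \<open>Let \<open>\<Phi>\<close> be the bump in space and \<open>\<eta>\<close> the cutoff in time. In \<open>\<eta> \<Delta>\<Phi> + \<Phi> \<eta>'\<close> the first term is bounded
  by the maximum of \<open>\<bar>\<Delta>\<Phi>\<bar>\<close>, since \<open>0 \<le> \<eta> \<le> 1\<close>. In the second, the derivative of the right flank of \<open>\<eta>\<close> is
  nonpositive and can be dropped, and the left flank contributes the derivative of \<open>exp (- 1 / s)\<close> at
  \<open>s = t / \<epsilon> - 1\<close>, divided by \<open>\<epsilon>\<close>. The point of the lemma is that \<open>C\<close> does not depend on \<open>\<epsilon>\<close>.\<close>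

lemma backward_heat_cutoff_le:
  fixes x :: "real ^ 'n"
  shows "\<exists>C\<ge>0. \<forall>\<epsilon>>0. \<forall>z\<in>cball x r \<times> {0<..\<tau>}.
    backward_heat (\<lambda>z. space_bump r x z * time_cutoff \<tau> \<epsilon> (snd z)) z \<le> C + flat_exp 2 (snd z / \<epsilon> - 1) / \<epsilon>"
proof -
  let ?\<Phi> = "space_bump r x"
  let ?d = "\<lambda>i z. frechet_derivative ?\<Phi> (at z) (space_dir i)"
  let ?L = "\<lambda>z. \<Sum>i\<in>UNIV. frechet_derivative (?d i) (at z) (space_dir i)"
  have \<Phi>d: "(?\<Phi> has_derivative frechet_derivative ?\<Phi> (at z)) (at z)" for z
    by (rule C_k_SucD[OF C_k_space_bump])
  have dd: "(?d i has_derivative frechet_derivative (?d i) (at z)) (at z)" for i z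
    by (rule C_k_SucD(1)[OF C_k_SucD(2)[OF C_k_space_bump]])
  have "continuous_on UNIV ?L"
    by (intro continuous_on_sum C_k.simps(1)[THEN iffD1] C_k_SucD(2)[OF C_k_SucD(2)[OF C_k_space_bump]])
  then have "compact (?L ` (cball x r \<times> {0..\<tau>}))"
    by (intro compact_continuous_image compact_Times) (auto intro: continuous_on_subset)
  then obtain C where C: "\<And>z. z \<in> cball x r \<times> {0..\<tau>} \<Longrightarrow> \<bar>?L z\<bar> \<le> C"
    using compact_imp_bounded[of "?L ` (cball x r \<times> {0..\<tau>})"] unfolding bounded_real by auto
  show ?thesis
  proof (intro exI[of _ "\<bar>C\<bar>"] conjI allI impI ballI)
    fix \<epsilon> :: real and z :: "(real ^ 'n) \<times> real"
    assume "\<epsilon> > 0" and z: "z \<in> cball x r \<times> {0<..\<tau>}"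
    let ?\<eta> = "time_cutoff \<tau> \<epsilon>"
    let ?\<eta>' = "\<lambda>t. flat_exp 2 (t / \<epsilon> - 1) / \<epsilon> * flat_exp 0 (\<tau> - t) - flat_exp 0 (t / \<epsilon> - 1) * flat_exp 2 (\<tau> - t)"
    have der: "(?\<eta> has_real_derivative ?\<eta>' t) (at t)" for t
    proof -
      have l: "((\<lambda>t. t / \<epsilon> - 1) has_real_derivative 1 / \<epsilon>) (at t)" "((\<lambda>t. \<tau> - t) has_real_derivative - 1) (at t)"
        using \<open>\<epsilon> > 0\<close> by (auto intro!: derivative_eq_intros)
      show ?thesis unfolding time_cutoff_def[abs_def]
        using DERIV_mult[OF DERIV_chain2[OF flat_exp_has_derivative[of 0] l(1)]
            DERIV_chain2[OF flat_exp_has_derivative[of 0] l(2)]]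
        by (simp add: mult_ac numeral_2_eq_2)
    qed
    have s: "frechet_derivative (\<lambda>z. ?\<Phi> z * ?\<eta> (snd z)) (at z) (space_dir i) = ?d i z * ?\<eta> (snd z)" for i z
      by (subst frechet_derivative_mult_time[OF \<Phi>d der]) (simp add: space_dir_def)
    have ss: "frechet_derivative (\<lambda>z. ?d i z * ?\<eta> (snd z)) (at z) (space_dir i)
        = frechet_derivative (?d i) (at z) (space_dir i) * ?\<eta> (snd z)" for i z
      by (subst frechet_derivative_mult_time[OF dd der]) (simp add: space_dir_def)
    have t: "frechet_derivative (\<lambda>z. ?\<Phi> z * ?\<eta> (snd z)) (at z) time_dir = ?\<Phi> z * ?\<eta>' (snd z)"
      by (subst frechet_derivative_mult_time[OF \<Phi>d der]) (simp add: space_bump_time_derivative, simp add: time_dir_def)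
    have "backward_heat (\<lambda>z. ?\<Phi> z * ?\<eta> (snd z)) z = ?L z * ?\<eta> (snd z) + ?\<Phi> z * ?\<eta>' (snd z)"
      unfolding backward_heat_def s ss t by (simp add: sum_distrib_right)
    moreover have "?L z * ?\<eta> (snd z) \<le> \<bar>C\<bar> * 1"
    proof -
      have "0 \<le> ?\<eta> (snd z)" "?\<eta> (snd z) \<le> 1"
        by (auto simp: time_cutoff_def flat_exp_bounds intro!: mult_le_one)
      moreover have "?L z \<le> \<bar>C\<bar>" using C[of z] z by force
      ultimately show ?thesis by (smt (verit) mult_left_le mult_right_mono)
    qed
    moreover have "?\<Phi> z * ?\<eta>' (snd z) \<le> 1 * (flat_exp 2 (snd z / \<epsilon> - 1) / \<epsilon>)"
    proof -
      have p: "0 \<le> flat_exp 2 (snd z / \<epsilon> - 1) / \<epsilon>" using \<open>\<epsilon> > 0\<close> by (simp add: flat_exp_bounds)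
      have "?\<eta>' (snd z) \<le> flat_exp 2 (snd z / \<epsilon> - 1) / \<epsilon>"
        using mult_left_le[OF flat_exp_bounds(2) p]
        by (smt (verit) flat_exp_bounds(1) mult_nonneg_nonneg)
      then have "?\<Phi> z * ?\<eta>' (snd z) \<le> ?\<Phi> z * (flat_exp 2 (snd z / \<epsilon> - 1) / \<epsilon>)"
        by (intro mult_left_mono) (auto simp: space_bump_def flat_exp_bounds)
      also have "\<dots> \<le> 1 * (flat_exp 2 (snd z / \<epsilon> - 1) / \<epsilon>)"
        using p by (intro mult_right_mono) (auto simp: space_bump_def flat_exp_bounds)
      finally show ?thesis .
    qed
    ultimately show "backward_heat (\<lambda>z. ?\<Phi> z * ?\<eta> (snd z)) z \<le> \<bar>C\<bar> + flat_exp 2 (snd z / \<epsilon> - 1) / \<epsilon>"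
      by simp
  qed simp
qed

section \<open>Integration over time slices\<close>

lemma AE_lborel_slices:
  fixes P :: "'a::euclidean_space \<times> 'b::euclidean_space \<Rightarrow> bool"
  assumes "AE z in lborel. P z"
  shows "AE t in lborel. AE y in lborel. P (y, t)"
proof -
  obtain N where N: "{z. \<not> P z} \<subseteq> N" "emeasure lborel N = 0" "N \<in> sets lborel"
    using AE_E[OF assms] by auto
  have m: "indicator N \<in> borel_measurable (lborel \<Otimes>\<^sub>M lborel :: ('a \<times> 'b) measure)"
    using N(3) by (simp add: lborel_prod)
  have "(\<integral>\<^sup>+ t. (\<integral>\<^sup>+ y. indicator N (y, t) \<partial>lborel) \<partial>lborel) = 0"
    using lborel_pair.nn_integral_snd[OF m] N by (simp add: lborel_prod)
  moreover have m': "(\<lambda>t. \<integral>\<^sup>+ y. indicator N (y, t) \<partial>lborel) \<in> borel_measurable lborel"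
    by (rule lborel.borel_measurable_nn_integral[OF measurable_pair_swap[OF m]])
  ultimately have "AE t in lborel. (\<integral>\<^sup>+ y. indicator N (y, t) \<partial>lborel) = 0"
    using nn_integral_0_iff_AE by blast
  then show ?thesis
  proof eventually_elim
    case (elim t)
    have "(\<lambda>y. indicator N (y, t)) \<in> borel_measurable lborel"
      by (rule measurable_compose[OF measurable_Pair2' m]) simp
    then have "AE y in lborel. (indicator N (y, t) :: ennreal) = 0"
      using elim nn_integral_0_iff_AE by blast
    then show ?case
      by eventually_elim (use N(1) in \<open>auto split: split_indicator_asm\<close>)
  qed
qed

lemma borel_measurable_ennreal_indicator:
  fixes f :: "'a::euclidean_space \<Rightarrow> real"
  assumes f: "f \<in> borel_measurable (lebesgue_on Q)" and Q: "Q \<in> sets borel"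
    and A: "A \<in> sets borel" "A \<subseteq> Q"
  shows "(\<lambda>z. ennreal (f z) * indicator A z) \<in> borel_measurable lebesgue"
proof -
  have "(\<lambda>z. if z \<in> Q then f z else 0) \<in> borel_measurable lebesgue"
    using Q by (intro borel_measurable_if_I[OF f] sets_completionI_sets) simp
  moreover have "indicator A \<in> borel_measurable (lebesgue :: 'a measure)"
    using A by (intro borel_measurable_indicator sets_completionI_sets) simp
  ultimately have "(\<lambda>z. ennreal (if z \<in> Q then f z else 0) * indicator A z) \<in> borel_measurable lebesgue"
    by (intro borel_measurable_times_ennreal measurable_compose[OF _ measurable_ennreal])
  also have "(\<lambda>z. ennreal (if z \<in> Q then f z else 0) * indicator A z) = (\<lambda>z. ennreal (f z) * indicator A z)"
    using A(2) by (intro ext) (auto split: split_indicator)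
  finally show ?thesis .
qed

text \<open>Fubini applied to a Borel function that agrees almost everywhere with \<open>u\<close> on \<open>B \<times> {0<..\<tau>}\<close>. The
  individual slices of \<open>u\<close> need not be measurable, but almost all of them agree almost everywhere with
  those of the Borel function, so that the bound \<open>M\<close> transfers.\<close>

lemma nn_integral_slices_le:
  fixes u :: "'a::euclidean_space \<times> real \<Rightarrow> real"
  assumes u: "u \<in> borel_measurable (lebesgue_on (UNIV \<times> {0<..T}))"
    and B: "B \<in> sets borel" and "\<tau> \<le> T" and w [measurable]: "w \<in> borel_measurable borel"
    and M: "\<And>t. t \<in> {0<..\<tau>} \<Longrightarrow> (\<integral>\<^sup>+ y\<in>B. ennreal (u (y, t)) \<partial>lebesgue) \<le> M"
  shows "(\<integral>\<^sup>+ z\<in>B \<times> {0<..\<tau>}. ennreal (u z) * w (snd z) \<partial>lebesgue)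
       \<le> M * (\<integral>\<^sup>+ t\<in>{0<..\<tau>}. w t \<partial>lborel)"
proof -
  let ?Q = "(UNIV :: 'a set) \<times> {0<..T}" and ?A = "B \<times> {0<..\<tau>}"
  let ?f = "\<lambda>z. ennreal (u z) * indicator ?A z"
  have "?f \<in> borel_measurable lebesgue"
    by (rule borel_measurable_ennreal_indicator[OF u]) (use B \<open>\<tau> \<le> T\<close> in \<open>auto intro!: borel_Times\<close>)
  from completion_ex_borel_measurable[OF this] obtain g where
    g: "g \<in> borel_measurable lborel" and fg: "AE z in lborel. ?f z = g z" by auto
  have "(\<integral>\<^sup>+ z\<in>?A. ennreal (u z) * w (snd z) \<partial>lebesgue) = (\<integral>\<^sup>+ z. g z * w (snd z) \<partial>lborel)"
    unfolding nn_integral_completion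
    by (rule nn_integral_cong_AE) (use fg in \<open>auto elim!: eventually_mono simp: mult_ac\<close>)
  also have gm: "(\<lambda>z. g z * w (snd z)) \<in> borel_measurable (lborel \<Otimes>\<^sub>M lborel)"
    using g w unfolding lborel_prod[symmetric] by measurable
  have "(\<integral>\<^sup>+ z. g z * w (snd z) \<partial>lborel) = (\<integral>\<^sup>+ t. \<integral>\<^sup>+ y. g (y, t) * w t \<partial>lborel \<partial>lborel)"
    using lborel_pair.nn_integral_snd[OF gm] by (simp add: lborel_prod)
  also have "\<dots> \<le> (\<integral>\<^sup>+ t. M * (w t * indicator {0<..\<tau>} t) \<partial>lborel)"
  proof (rule nn_integral_mono_AE)
    show "AE t in lborel. (\<integral>\<^sup>+ y. g (y, t) * w t \<partial>lborel) \<le> M * (w t * indicator {0<..\<tau>} t)"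
      using AE_lborel_slices[OF fg]
    proof eventually_elim
      case (elim t)
      have gt: "(\<lambda>y. g (y, t)) \<in> borel_measurable lborel"
        using g unfolding lborel_prod[symmetric] by measurable
      have "(\<integral>\<^sup>+ y. g (y, t) * w t \<partial>lborel) = (\<integral>\<^sup>+ y. g (y, t) \<partial>lborel) * w t"
        by (rule nn_integral_multc[OF gt])
      also have "(\<integral>\<^sup>+ y. g (y, t) \<partial>lborel) = (\<integral>\<^sup>+ y. ?f (y, t) \<partial>lborel)"
        by (rule nn_integral_cong_AE) (use elim in auto)
      also have "\<dots> = (\<integral>\<^sup>+ y\<in>B. ennreal (u (y, t)) \<partial>lebesgue) * indicator {0<..\<tau>} t"
        by (auto simp: nn_integral_completion indicator_times split: split_indicator)
      also have "\<dots> \<le> M * indicator {0<..\<tau>} t"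
        using M by (auto split: split_indicator)
      finally show ?case by (simp add: mult_ac mult_right_mono)
    qed
  qed
  also have "\<dots> = M * (\<integral>\<^sup>+ t\<in>{0<..\<tau>}. w t \<partial>lborel)"
    by (rule nn_integral_cmult) simp
  finally show ?thesis .
qed

text \<open>The second summand is the derivative of \<open>t \<mapsto> flat_exp 0 (t / \<epsilon> - 1)\<close>, which takes values in \<open>[0, 1]\<close>;
  so its integral is at most \<open>1\<close>, however steep the flank is.\<close>

lemma nn_integral_cutoff_slope_le:
  assumes "\<epsilon> > 0" "\<tau> > 0" "C \<ge> 0"
  shows "(\<integral>\<^sup>+ t\<in>{0<..\<tau>}. ennreal (C + flat_exp 2 (t / \<epsilon> - 1) / \<epsilon>) \<partial>lborel) \<le> ennreal (C * \<tau> + 1)"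
proof -
  let ?f = "\<lambda>t. C + flat_exp 2 (t / \<epsilon> - 1) / \<epsilon>" and ?F = "\<lambda>t. C * t + flat_exp 0 (t / \<epsilon> - 1)"
  have cont: "continuous_on UNIV (flat_exp 2)"
    using DERIV_isCont[OF flat_exp_has_derivative] by (simp add: continuous_at_imp_continuous_on)
  have "continuous_on UNIV ?f"
    using \<open>\<epsilon> > 0\<close> by (intro continuous_intros continuous_on_compose2[OF cont]) auto
  then have m: "?f \<in> borel_measurable borel" by (rule borel_measurable_continuous_onI)
  have d: "(?F has_real_derivative ?f t) (at t)" for t
  proof -
    have "((\<lambda>t. t / \<epsilon> - 1) has_real_derivative 1 / \<epsilon>) (at t)"
      using \<open>\<epsilon> > 0\<close> by (auto intro!: derivative_eq_intros)
    from DERIV_add[OF DERIV_cmult_Id[of C] DERIV_chain2[OF flat_exp_has_derivative[of 0] this]]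
    show ?thesis by (simp add: numeral_2_eq_2)
  qed
  have "(\<integral>\<^sup>+ t\<in>{0<..\<tau>}. ennreal (?f t) \<partial>lborel) \<le> (\<integral>\<^sup>+ t\<in>{0..\<tau>}. ennreal (?f t) \<partial>lborel)"
    by (intro nn_integral_mono) (auto split: split_indicator)
  also have "\<dots> = ennreal (?F \<tau> - ?F 0)"
    by (rule nn_integral_FTC_Icc[OF m]) (use d assms in \<open>auto simp: flat_exp_bounds\<close>)
  also have "?F \<tau> - ?F 0 \<le> C * \<tau> + 1"
    using flat_exp_bounds(2)[of "\<tau> / \<epsilon> - 1"] flat_exp_bounds(1)[of 0 "0 / \<epsilon> - 1"] by simp
  finally show ?thesis by (simp add: ennreal_leI)
qed

lemma cutoff_ge:
  fixes x :: "real ^ 'n"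
  assumes "r > 0" "\<epsilon> > 0" "z \<in> ball x (r / 2) \<times> {2 * \<epsilon>..\<tau> / 2}"
  shows "flat_exp 0 (3 / 4 * r\<^sup>2) * (flat_exp 0 1 * flat_exp 0 (\<tau> / 2))
     \<le> space_bump r x z * time_cutoff \<tau> \<epsilon> (snd z)"
proof -
  have "norm (fst z - x) \<le> r / 2" using assms by (auto simp: dist_norm norm_minus_commute)
  then have "(norm (fst z - x))\<^sup>2 \<le> (r / 2)\<^sup>2" by (intro power_mono) auto
  then have "3 / 4 * r\<^sup>2 \<le> r\<^sup>2 - (fst z - x) \<bullet> (fst z - x)"
    by (simp add: power2_norm_eq_inner power_divide)
  moreover have "1 \<le> snd z / \<epsilon> - 1" "\<tau> / 2 \<le> \<tau> - snd z"
    using assms by (auto simp: field_simps)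
  ultimately show ?thesis unfolding space_bump_def time_cutoff_def
    by (intro mult_mono flat_exp_0_mono mult_nonneg_nonneg flat_exp_bounds)
qed

section \<open>The absorbed mass\<close>

text \<open>The heart of the matter: a bound on the masses of the slices bounds the integral of \<open>u V\<close> uniformly as
  the lower time limit tends to \<open>0\<close>. Test the equation with the cutoff; its adjoint heat operator costs
  a constant plus an \<open>\<epsilon>\<close>-dependent function of time alone, whose integral in time is at most \<open>1\<close>, and
  slice by slice this is paired with a mass of at most \<open>M\<close>.\<close>

lemma absorption_nn_integral_le:
  fixes u V :: "(real ^ 'n) \<times> real \<Rightarrow> real" and x :: "real ^ 'n" and T :: real
  assumes sol: "strong_solution T V u"
    and u: "u \<in> borel_measurable (lebesgue_on (parabolic_cylinder T))"
    and V: "V \<in> borel_measurable (lebesgue_on (parabolic_cylinder T))"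
    and u0: "AE z in lebesgue. z \<in> parabolic_cylinder T \<longrightarrow> 0 \<le> u z"
    and V0: "AE z in lebesgue. z \<in> parabolic_cylinder T \<longrightarrow> 0 \<le> V z"
    and r: "0 < r" and \<tau>: "0 < \<tau>" "\<tau> < T"
    and M: "\<And>t. t \<in> {0<..\<tau>} \<Longrightarrow> (\<integral>\<^sup>+ y\<in>cball x r. ennreal (u (y, t)) \<partial>lebesgue) \<le> ennreal M"
  shows "\<exists>K. \<forall>\<epsilon>>0. (\<integral>\<^sup>+ z\<in>ball x (r / 2) \<times> {2 * \<epsilon>..\<tau> / 2}. ennreal (u z * V z) \<partial>lebesgue) \<le> ennreal K"
proof -
  let ?\<Omega> = "(UNIV :: (real ^ 'n) set) \<times> {0<..<T}" and ?A = "cball x r \<times> {0<..\<tau>}"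
  \<comment> \<open>A lower bound for the cutoff on the smaller cylinder, independent of \<open>\<epsilon>\<close>.\<close>
  define c where "c = flat_exp 0 (3 / 4 * r\<^sup>2) * (flat_exp 0 1 * flat_exp 0 (\<tau> / 2))"
  have "c > 0" unfolding c_def using r \<tau> by (simp add: flat_exp_def)
  obtain C where C: "C \<ge> 0" "\<And>\<epsilon> z. \<epsilon> > 0 \<Longrightarrow> z \<in> ?A \<Longrightarrow>
      backward_heat (\<lambda>z. space_bump r x z * time_cutoff \<tau> \<epsilon> (snd z)) z \<le> C + flat_exp 2 (snd z / \<epsilon> - 1) / \<epsilon>"
    using backward_heat_cutoff_le[of x r \<tau>] by blast
  have "(\<integral>\<^sup>+ z\<in>ball x (r / 2) \<times> {2 * \<epsilon>..\<tau> / 2}. ennreal (u z * V z) \<partial>lebesgue)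
      \<le> ennreal (M * (C * \<tau> + 1) / c)" if "\<epsilon> > 0" for \<epsilon>
  proof -
    let ?S = "ball x (r / 2) \<times> {2 * \<epsilon>..\<tau> / 2}"
    define \<psi> where "\<psi> = (\<lambda>z. space_bump r x z * time_cutoff \<tau> \<epsilon> (snd z))"
    have test: "test_function ?\<Omega> \<psi>" and supp: "closure {z. \<psi> z \<noteq> 0} \<subseteq> ?A"
      using test_function_cutoff[OF that \<tau>(2) r] unfolding \<psi>_def by auto
    have \<psi>0: "0 \<le> \<psi> z" for z
      by (simp add: \<psi>_def space_bump_def time_cutoff_def flat_exp_bounds)
    have outside: "backward_heat \<psi> z = 0" if "z \<notin> ?A" for z
    proof -
      have z: "z \<notin> closure {z. \<psi> z \<noteq> 0}" using that supp by blast
      have "frechet_derivative (\<lambda>z. frechet_derivative \<psi> (at z) v) (at z) v = 0" for v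
        using test_function_derivative_support z by (intro frechet_derivative_outside_support) blast
      then show ?thesis
        unfolding backward_heat_def by (simp add: frechet_derivative_outside_support[OF z])
    qed
    have w: "(\<lambda>t. ennreal (C + flat_exp 2 (t / \<epsilon> - 1) / \<epsilon>)) \<in> borel_measurable borel"
      unfolding flat_exp_def by measurable
    have "ennreal c * (\<integral>\<^sup>+ z\<in>?S. ennreal (u z * V z) \<partial>lebesgue) 
        = (\<integral>\<^sup>+ z. ennreal c * (ennreal (u z * V z) * indicator ?S z) \<partial>lebesgue)"
    proof (rule nn_integral_cmult[symmetric], rule borel_measurable_ennreal_indicator)
      show "(\<lambda>z. u z * V z) \<in> borel_measurable (lebesgue_on (parabolic_cylinder T))"
        using u V by (rule borel_measurable_times)
      show "?S \<subseteq> parabolic_cylinder T" "parabolic_cylinder T \<in> sets borel" "?S \<in> sets borel"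
        using that \<tau> by (auto simp: parabolic_cylinder_def intro!: borel_Times)
    qed
    also have "\<dots> \<le> (\<integral>\<^sup>+ z\<in>?\<Omega>. ennreal (u z * V z * \<psi> z) \<partial>lebesgue)"
    proof (rule nn_integral_mono_AE)
      show "AE z in lebesgue. ennreal c * (ennreal (u z * V z) * indicator ?S z)
          \<le> ennreal (u z * V z * \<psi> z) * indicator ?\<Omega> z"
        using u0 V0
      proof eventually_elim
        case (elim z)
        show ?case
        proof (cases "z \<in> ?S")
          case True
          then have z: "z \<in> ?\<Omega>" using that \<tau> by auto
          then have uV: "0 \<le> u z * V z" using elim by (auto simp: parabolic_cylinder_def)
          then have "u z * V z * c \<le> u z * V z * \<psi> z"
            using cutoff_ge[OF r that True] unfolding \<psi>_def c_def by (intro mult_left_mono)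
          with True z uV \<open>c > 0\<close> show ?thesis
            by (simp add: ennreal_mult'[symmetric] ennreal_leI mult.commute)
        qed simp
      qed
    qed
    also have "\<dots> \<le> (\<integral>\<^sup>+ z\<in>?\<Omega>. ennreal (u z * backward_heat \<psi> z) \<partial>lebesgue)"
    proof (rule strong_solution_test_le[OF sol test])
      show "AE z in lebesgue. z \<in> ?\<Omega> \<longrightarrow> 0 \<le> u z * V z * \<psi> z"
        using u0 V0 by eventually_elim (auto simp: parabolic_cylinder_def \<psi>0)
    qed
    also have "\<dots> \<le> (\<integral>\<^sup>+ z\<in>?A. ennreal (u z) * ennreal (C + flat_exp 2 (snd z / \<epsilon> - 1) / \<epsilon>) \<partial>lebesgue)"
    proof (rule nn_integral_mono_AE)
      show "AE z in lebesgue. ennreal (u z * backward_heat \<psi> z) * indicator ?\<Omega> z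
          \<le> ennreal (u z) * ennreal (C + flat_exp 2 (snd z / \<epsilon> - 1) / \<epsilon>) * indicator ?A z"
        using u0
      proof eventually_elim
        case (elim z)
        show ?case
        proof (cases "z \<in> ?A \<and> z \<in> ?\<Omega>")
          case True
          then have "0 \<le> u z" using elim by (auto simp: parabolic_cylinder_def)
          then have "u z * backward_heat \<psi> z \<le> u z * (C + flat_exp 2 (snd z / \<epsilon> - 1) / \<epsilon>)"
            using C(2)[OF that, of z] True unfolding \<psi>_def by (intro mult_left_mono) auto
          with True \<open>0 \<le> u z\<close> show ?thesis by (simp add: ennreal_mult'[symmetric] ennreal_leI)
        next
          case False
          then show ?thesis using outside[of z] by (auto split: split_indicator)
        qed
      qed
    qed
    also have "\<dots> \<le> ennreal M * (\<integral>\<^sup>+ t\<in>{0<..\<tau>}. ennreal (C + flat_exp 2 (t / \<epsilon> - 1) / \<epsilon>) \<partial>lborel)"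
      by (rule nn_integral_slices_le[OF u[unfolded parabolic_cylinder_def] _ _ w M]) (use \<tau> in auto)
    also have "\<dots> \<le> ennreal M * ennreal (C * \<tau> + 1)"
      by (intro mult_left_mono nn_integral_cutoff_slope_le that \<tau> C) simp
    also have "\<dots> = ennreal (M * (C * \<tau> + 1))"
      using C \<tau> by (simp add: ennreal_mult'')
    finally have "ennreal (1 / c) * (ennreal c * (\<integral>\<^sup>+ z\<in>?S. ennreal (u z * V z) \<partial>lebesgue))
        \<le> ennreal (1 / c) * ennreal (M * (C * \<tau> + 1))"
      by (rule mult_left_mono) simp
    then show ?thesis
      using \<open>c > 0\<close> by (simp add: mult.assoc[symmetric] ennreal_mult'[symmetric])
  qed
  then show ?thesis by blast
qed

lemma nn_integral_le_from_truncations: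
  fixes f :: "'a::euclidean_space \<times> real \<Rightarrow> ennreal"
  assumes f: "(\<lambda>z. f z * indicator (B \<times> {0<..\<tau>}) z) \<in> borel_measurable lebesgue" and B: "B \<in> sets borel"
    and K: "\<And>\<epsilon>. \<epsilon> > 0 \<Longrightarrow> (\<integral>\<^sup>+ z\<in>B \<times> {2 * \<epsilon>..\<tau>}. f z \<partial>lebesgue) \<le> K"
  shows "(\<integral>\<^sup>+ z\<in>B \<times> {0<..\<tau>}. f z \<partial>lebesgue) \<le> K"
proof -
  \<comment> \<open>Truncations at \<open>\<epsilon> = 1 / (n + 1)\<close>; they increase to the whole strip.\<close>
  let ?S = "\<lambda>n::nat. B \<times> {2 * (1 / (real n + 1))..\<tau>}"
  let ?F = "\<lambda>z. f z * indicator (B \<times> {0<..\<tau>}) z"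
  have S: "?S n \<in> sets lebesgue" for n
    using B by (intro sets_completionI_sets) (auto intro!: borel_Times)
  have "\<exists>n. z \<in> ?S n" if z: "z \<in> B \<times> {0<..\<tau>}" for z
  proof -
    have "0 < snd z / 2" using z by auto
    then obtain n :: nat where "1 / (real n + 1) < snd z / 2"
      using reals_Archimedean[of "snd z / 2"] by (auto simp: inverse_eq_divide add.commute)
    then have "z \<in> ?S n" using z by auto
    then show ?thesis ..
  qed
  then have sup: "?F z = (SUP n. ?F z * indicator (?S n) z)" for z
  proof (cases "z \<in> B \<times> {0<..\<tau>}")
    case True
    with \<open>\<And>z. z \<in> B \<times> {0<..\<tau>} \<Longrightarrow> \<exists>n. z \<in> ?S n\<close> obtain n where n: "z \<in> ?S n" by blast
    show ?thesis
    proof (rule antisym)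
      show "?F z \<le> (SUP n. ?F z * indicator (?S n) z)"
        by (rule SUP_upper2[of n]) (use n in auto)
      show "(SUP n. ?F z * indicator (?S n) z) \<le> ?F z"
        by (rule SUP_least) (auto split: split_indicator)
    qed
  qed simp
  have "?S m \<subseteq> ?S n" if "m \<le> n" for m n
  proof -
    have "1 / (real n + 1) \<le> 1 / (real m + 1)" using that by (intro divide_left_mono) auto
    then show ?thesis by auto
  qed
  then have inc: "incseq (\<lambda>n z. ?F z * indicator (?S n) z)"
    by (intro monoI le_funI mult_left_mono indicator_leI) auto
  have "(\<integral>\<^sup>+ z\<in>B \<times> {0<..\<tau>}. f z \<partial>lebesgue) = (\<integral>\<^sup>+ z. (SUP n. ?F z * indicator (?S n) z) \<partial>lebesgue)"
    by (rule nn_integral_cong) (rule sup)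
  also have "\<dots> = (SUP n. \<integral>\<^sup>+ z. ?F z * indicator (?S n) z \<partial>lebesgue)"
    by (rule nn_integral_monotone_convergence_SUP[OF inc])
      (intro borel_measurable_times_ennreal f borel_measurable_indicator S)
  also have "\<dots> \<le> K"
  proof (rule SUP_least)
    fix n :: nat
    have "(\<integral>\<^sup>+ z. ?F z * indicator (?S n) z \<partial>lebesgue) \<le> (\<integral>\<^sup>+ z\<in>?S n. f z \<partial>lebesgue)"
      by (intro nn_integral_mono) (auto split: split_indicator)
    also have "\<dots> \<le> K" by (rule K) simp
    finally show "(\<integral>\<^sup>+ z. ?F z * indicator (?S n) z \<partial>lebesgue) \<le> K" .
  qed
  finally show ?thesis .
qed

lemma Lp_loc_1_mult_Linf_loc_finite:
  fixes u V :: "'a::euclidean_space \<Rightarrow> real"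
  assumes V: "V \<in> Linf_loc Q" and u: "u \<in> Lp_loc 1 Q" and K: "compact K" "K \<subseteq> Q"
  shows "(\<integral>\<^sup>+ z\<in>K. ennreal (u z * V z) \<partial>lebesgue) < \<infinity>"
proof -
  obtain C where C: "AE z in lebesgue. z \<in> K \<longrightarrow> \<bar>V z\<bar> \<le> C"
    using V K unfolding Linf_loc_def by blast
  have "set_integrable lebesgue K (\<lambda>z. C * \<bar>u z\<bar>)"
    using u K by (simp add: Lp_loc_def)
  then have i: "integrable lebesgue (\<lambda>z. indicator K z *\<^sub>R (C * \<bar>u z\<bar>))"
    unfolding set_integrable_def .
  have "(\<integral>\<^sup>+ z\<in>K. ennreal (u z * V z) \<partial>lebesgue) \<le> (\<integral>\<^sup>+ z. ennreal (indicator K z *\<^sub>R (C * \<bar>u z\<bar>)) \<partial>lebesgue)"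
  proof (rule nn_integral_mono_AE)
    show "AE z in lebesgue. ennreal (u z * V z) * indicator K z \<le> ennreal (indicator K z *\<^sub>R (C * \<bar>u z\<bar>))"
      using C
    proof eventually_elim
      case (elim z)
      have "u z * V z \<le> C * \<bar>u z\<bar>" if "z \<in> K"
      proof -
        have "u z * V z \<le> \<bar>V z\<bar> * \<bar>u z\<bar>" by (metis abs_ge_self abs_mult mult.commute)
        also have "\<dots> \<le> C * \<bar>u z\<bar>" using elim that by (intro mult_right_mono) auto
        finally show ?thesis .
      qed
      then show ?case by (auto intro!: ennreal_leI split: split_indicator)
    qed
  qed
  also have "\<dots> < \<infinity>" using integrableD(2)[OF i] by (simp add: less_top)
  finally show ?thesis .
qed

section \<open>Unbounded mass near time zero\<close>

theorem proposition4p2: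
  fixes T :: real and u V :: "(real ^ 'n) \<times> real \<Rightarrow> real" and x :: "real ^ 'n"
  assumes "T > 0"
    and "V \<in> Linf_loc (parabolic_cylinder T)"
    and "AE z in lebesgue. z \<in> parabolic_cylinder T \<longrightarrow> V z \<ge> 0"
    and "\<And>p. 1 \<le> p \<Longrightarrow> u \<in> W21_loc p T"
    and "AE z in lebesgue. z \<in> parabolic_cylinder T \<longrightarrow> u z > 0"
    and "strong_solution T V u"
    and "\<And>U. open U \<Longrightarrow> bounded U \<Longrightarrow> x \<in> U \<Longrightarrow>
      (\<integral>\<^sup>+ z \<in> U \<times> {0<..<T}. ennreal (u z * V z) \<partial>lebesgue) = \<infinity>"
  shows "\<forall>U. open U \<and> bounded U \<and> x \<in> U \<longrightarrow>
    Limsup (at_right 0) (\<lambda>t. \<integral>\<^sup>+ y \<in> U. ennreal (u (y, t)) \<partial>lebesgue) = \<infinity>"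
proof (intro allI impI, elim conjE, rule ccontr)
  fix U :: "(real ^ 'n) set"
  assume U: "open U" "bounded U" "x \<in> U"
    and "Limsup (at_right 0) (\<lambda>t. \<integral>\<^sup>+ y\<in>U. ennreal (u (y, t)) \<partial>lebesgue) \<noteq> \<infinity>"
  then have "Limsup (at_right 0) (\<lambda>t. \<integral>\<^sup>+ y\<in>U. ennreal (u (y, t)) \<partial>lebesgue) < \<infinity>"
    by (simp add: less_top)
  then obtain m where m: "Limsup (at_right 0) (\<lambda>t. \<integral>\<^sup>+ y\<in>U. ennreal (u (y, t)) \<partial>lebesgue) < m" "m < \<infinity>"
    using dense by blast
  obtain M where M: "m = ennreal M" using m(2) by (cases m) auto
  obtain t0 where t0: "t0 > 0" "\<And>t. 0 < t \<Longrightarrow> t < t0 \<Longrightarrow> (\<integral>\<^sup>+ y\<in>U. ennreal (u (y, t)) \<partial>lebesgue) < ennreal M"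
    using Limsup_lessD[OF m(1)] unfolding M eventually_at_right_field by blast
  obtain r where r: "r > 0" "cball x r \<subseteq> U" using U open_contains_cball by blast
  define \<tau> where "\<tau> = min t0 T / 2"
  have \<tau>: "0 < \<tau>" "\<tau> < t0" "\<tau> < T" using t0(1) \<open>T > 0\<close> by (auto simp: \<tau>_def)
  let ?Q = "parabolic_cylinder T :: ((real ^ 'n) \<times> real) set" and ?B = "ball x (r / 2)"
  have Q: "?Q \<in> sets borel" by (auto simp: parabolic_cylinder_def intro!: borel_Times)
  have u: "u \<in> Lp_loc 1 ?Q" using assms(4)[of 1] by (simp add: W21_loc_def)
  have um: "u \<in> borel_measurable (lebesgue_on ?Q)" and Vm: "V \<in> borel_measurable (lebesgue_on ?Q)"
    using u assms(2) by (auto simp: Lp_loc_def Linf_loc_def)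
  have uVm: "(\<lambda>z. u z * V z) \<in> borel_measurable (lebesgue_on ?Q)"
    using um Vm by (rule borel_measurable_times)
  have slice: "(\<integral>\<^sup>+ y\<in>cball x r. ennreal (u (y, t)) \<partial>lebesgue) \<le> ennreal M" if "t \<in> {0<..\<tau>}" for t
  proof -
    have "(\<integral>\<^sup>+ y\<in>cball x r. ennreal (u (y, t)) \<partial>lebesgue) \<le> (\<integral>\<^sup>+ y\<in>U. ennreal (u (y, t)) \<partial>lebesgue)"
      using r(2) by (intro nn_integral_mono) (auto split: split_indicator)
    also have "\<dots> \<le> ennreal M" using t0(2)[of t] that \<tau> by (simp add: less_imp_le)
    finally show ?thesis .
  qed
  have u0: "AE z in lebesgue. z \<in> ?Q \<longrightarrow> 0 \<le> u z"
    using assms(5) by eventually_elim auto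
  obtain K where K: "\<And>\<epsilon>. \<epsilon> > 0 \<Longrightarrow>
      (\<integral>\<^sup>+ z\<in>?B \<times> {2 * \<epsilon>..\<tau> / 2}. ennreal (u z * V z) \<partial>lebesgue) \<le> ennreal K"
    using absorption_nn_integral_le[OF assms(6) um Vm u0 assms(3) r(1) \<tau>(1,3) slice] by blast
  have near: "(\<integral>\<^sup>+ z\<in>?B \<times> {0<..\<tau> / 2}. ennreal (u z * V z) \<partial>lebesgue) \<le> ennreal K"
  proof (rule nn_integral_le_from_truncations[OF _ _ K])
    show "(\<lambda>z. ennreal (u z * V z) * indicator (?B \<times> {0<..\<tau> / 2}) z) \<in> borel_measurable lebesgue"
      by (rule borel_measurable_ennreal_indicator[OF uVm Q])
        (use \<tau> in \<open>auto simp: parabolic_cylinder_def intro!: borel_Times\<close>)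
  qed auto
  \<comment> \<open>The closed cylinder reaches up to the final time, where \<open>V\<close> is still locally bounded.\<close>
  let ?K = "cball x (r / 2) \<times> {\<tau> / 2..T}"
  have away: "(\<integral>\<^sup>+ z\<in>?K. ennreal (u z * V z) \<partial>lebesgue) < \<infinity>"
    by (rule Lp_loc_1_mult_Linf_loc_finite[OF assms(2) u])
      (use \<tau> in \<open>auto simp: parabolic_cylinder_def intro!: compact_Times\<close>)
  have "(\<integral>\<^sup>+ z\<in>?B \<times> {0<..<T}. ennreal (u z * V z) \<partial>lebesgue)
      \<le> (\<integral>\<^sup>+ z. ennreal (u z * V z) * indicator (?B \<times> {0<..\<tau> / 2}) z
            + ennreal (u z * V z) * indicator ?K z \<partial>lebesgue)"
    by (intro nn_integral_mono) (auto split: split_indicator)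
  also have "\<dots> = (\<integral>\<^sup>+ z\<in>?B \<times> {0<..\<tau> / 2}. ennreal (u z * V z) \<partial>lebesgue)
      + (\<integral>\<^sup>+ z\<in>?K. ennreal (u z * V z) \<partial>lebesgue)"
    by (intro nn_integral_add borel_measurable_ennreal_indicator[OF uVm Q])
      (use \<tau> in \<open>auto simp: parabolic_cylinder_def intro!: borel_Times\<close>)
  also have "\<dots> < \<infinity>"
    using le_less_trans[OF near, of \<infinity>] away by simp
  finally show False
    using assms(7)[of ?B] r by simp
qed

end
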